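(* (Associativity) For all $P_0, P_1, P_2 \in EC \setminus \{\infty\}$, $(P_0 \oplus P_1) \oplus P_2 = P_0 \oplus (P_1 \oplus P_2)$.
   Context: Let $\wp = 2^{255}-19$ (a prime), $A = 486662$, and let $\mathbb{F}_\wp$ be the field of order $\wp$. Let $EC = \{(x,y) \in \mathbb{F}_\wp \times \mathbb{F}_\wp \mid y^2 = x^3 + Ax^2 + x\} \cup \{\infty\}$, where $\infty$ is a formal extra point. The operation $\oplus$ on points $P, Q \in EC$ is defined by: (1) $P \oplus \infty = \infty \oplus P = P$. (2) If $P = (x,y)$, then $P \oplus (x,-y) = \infty$. (3) If $P = (x_1,y_1)$ and $Q = (x_2,y_2) \neq (x_1,-y_1)$, let $\lambda = \frac{y_2-y_1}{x_2-x_1}$ if $x_1 \neq x_2$ and $\lambda = \frac{3x_1^2+2Ax_1+1}{2y_1}$ if $x_1 = x_2$; then $P \oplus Q = (x,y)$, where $x = \lambda^2 - A - x_1 - x_2$ and $y = \lambda(x_1 - x) - y_1$. All arithmetic is in $\mathbb{F}_\wp$. *)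

theory Defs
  imports Complex_Main "HOL-Library.Cardinality"
begin

text \<open>
  The field of order \<open>2^255 - 19\<close> is rendered as a type \<open>'a :: field\<close> subject to the
  assumption \<open>CARD('a) = p25519\<close>; such a field is unique up to isomorphism. The definitions
  below make sense over any field.
\<close>

definition p25519 :: nat where
  "p25519 = 2 ^ 255 - 19"

definition curve_A :: "'a :: field" where
  "curve_A = 486662"

datatype 'a point = Infinity | Affine 'a 'a

definition EC :: "'a :: field point set" where
  "EC = {Affine x y | x y. y\<^sup>2 = x ^ 3 + curve_A * x\<^sup>2 + x} \<union> {Infinity}"

text \<open>
  The operation is total on the type; only its values on \<open>EC\<close> are meaningful. On \<open>EC\<close>, in
  odd characteristic, no division below is by zero: if \<open>x1 = x2\<close> and \<open>y2 \<noteq> -y1\<close>, then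
  \<open>y1 = y2 \<noteq> 0\<close>.
\<close>

fun ec_add :: "'a :: field point \<Rightarrow> 'a point \<Rightarrow> 'a point" (infixl "\<oplus>" 65) where
  "P \<oplus> Infinity = P"
| "Infinity \<oplus> Q = Q"
| "Affine x1 y1 \<oplus> Affine x2 y2 =
    (if x2 = x1 \<and> y2 = - y1 then Infinity
     else
       let l = (if x1 \<noteq> x2 then (y2 - y1) / (x2 - x1)
                else (3 * x1\<^sup>2 + 2 * curve_A * x1 + 1) / (2 * y1));
           x = l\<^sup>2 - curve_A - x1 - x2;
           y = l * (x1 - x) - y1
       in Affine x y)"

end

theory Submission imports Defs begin

text \<open>
  A line \<open>y = l x + n\<close> meets the curve where \<open>x\<^sup>3 + A x\<^sup>2 + x - (l x + n)\<^sup>2\<close> vanishes. Stating by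
  Vieta's formulas that \<open>x1\<close>, \<open>x2\<close>, \<open>x3\<close> are the roots of this cubic treats chords and tangents
  alike, so that no separate computation for doublings is needed.

  Let the line of slope \<open>l\<close> carry \<open>P0\<close>, \<open>P1\<close>, \<open>U = - (P0 \<oplus> P1)\<close>, and the line of slope
  \<open>m\<close> carry \<open>P2\<close>, \<open>P1\<close>, \<open>V = - (P1 \<oplus> P2)\<close>. If \<open>l = m\<close>, both lines coincide and the claim is a
  matter of cancellation. Otherwise the line of slope \<open>m + b\<close> with \<open>b = (v - u) / (l - m)\<close>,
  where \<open>u\<close>, \<open>v\<close> are the abscissae of \<open>U\<close>, \<open>V\<close>, passes through \<open>- U\<close> and \<open>P2\<close>, and
  symmetrically the line of slope \<open>l + b\<close> passes through \<open>- V\<close> and \<open>P0\<close>; the third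
  intersection point of both has the abscissa \<open>x1 + b (l + m + b)\<close>.
\<close>

section \<open>The characteristic of the field and nonsingularity\<close>

text \<open>Translation by 1 permutes a finite ring, so adding 1 to every element leaves the sum of
  all elements unchanged. For an infinite type \<open>CARD\<close> is 0 by convention.\<close>

lemma of_nat_CARD_eq_0: "of_nat CARD('a::ring_1) = (0::'a)"
proof (cases "finite (UNIV :: 'a set)")
  case True
  have "(\<Sum>x\<in>UNIV. x + (1::'a)) = (\<Sum>x\<in>UNIV. x)"
    by (rule sum.reindex_bij_witness[of _ "\<lambda>x. x - 1" "\<lambda>x. x + 1"]) auto
  with True show ?thesis
    by (simp add: sum.distrib)
qed simp

lemma curve_A_square_ne_4:
  assumes "CARD('a::field) = p25519"
  shows "(curve_A :: 'a)\<^sup>2 \<noteq> 4"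
proof
  assume A: "(curve_A :: 'a)\<^sup>2 = 4"
  have "of_nat 236839902240 = (curve_A :: 'a)\<^sup>2 - 4"
    by (simp add: curve_A_def)
  hence D: "of_nat 236839902240 = (0::'a)"
    by (simp only: A diff_self)
  have p: "of_nat p25519 = (0::'a)"
    using of_nat_CARD_eq_0[where 'a='a] unfolding assms .
  have p_eq: "p25519 =
      57896044618658097711785492504343953926634992332820282019728792003956564819949"
    by (simp add: p25519_def)
  \<comment> \<open>Bezout coefficients for \<open>p25519\<close> and \<open>A\<^sup>2 - 4\<close>.\<close>
  have "135370866949 * p25519 =
      33091711653400878334459640397772451772377879251964723844336963003773021730565
        * 236839902240 + 1"
    unfolding p_eq by simp
  from arg_cong [OF this, of "of_nat :: nat \<Rightarrow> 'a"] show False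
    by (simp only: of_nat_mult of_nat_add of_nat_1 D p mult_zero_right add_0_left zero_neq_one)
qed

section \<open>Root triples of the cubic cut out by a line\<close>

definition collinear_abscissae :: "'a::field \<Rightarrow> 'a \<Rightarrow> 'a \<Rightarrow> 'a \<Rightarrow> 'a \<Rightarrow> bool" where
  "collinear_abscissae x1 x2 x3 l n \<longleftrightarrow>
     x1 + x2 + x3 = l\<^sup>2 - curve_A \<and>
     x1 * x2 + x1 * x3 + x2 * x3 = 1 - 2 * l * n \<and>
     x1 * x2 * x3 = n\<^sup>2"

text \<open>The explicit formulas for \<open>s\<close> and \<open>X\<close> are kept so that two
  applications, with the two lines interchanged, can be compared.\<close>

lemma collinear_abscissae_exchange:
  fixes x0 x1 x2 :: "'a::field"
  assumes P: "collinear_abscissae x0 x1 u l n"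
    and Q: "collinear_abscissae x2 x1 v m k"
    and eq: "l * x1 + n = m * x1 + k" and ne: "l \<noteq> m"
  obtains X s r where
    "collinear_abscissae u x2 X s r" "s * u + r = - (l * u + n)" "s * x2 + r = m * x2 + k"
    "s = m + (v - u) / (l - m)" "X = x1 + (s + l) * (s - m)" "(l - m) * (s + l) = x0 - x2"
proof -
  define d where "d = l - m"
  have d: "d \<noteq> 0" using ne by (simp add: d_def)
  define b where "b = (v - u) / d"
  define s where "s = m + b"
  define a where "a = s + l"
  have l: "l = m + d" by (simp add: d_def)
  have n: "n = k - d * x1" using eq by (simp add: l algebra_simps)
  note P' = P[unfolded collinear_abscissae_def]
  note Q' = Q[unfolded collinear_abscissae_def]
  \<comment> \<open>This intercept makes the line of slope \<open>s\<close> pass through the point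
    with abscissa \<open>x2\<close> on the line of slope \<open>m\<close>.\<close>
  define r where "r = k - b * x2"
  define X where "X = x1 + a * b"
  have v: "v = u + d * b"
    using d by (simp add: b_def)
  have m: "2 * m = a - b - d"
    by (simp add: a_def s_def l)
  have da: "d * a = x0 - x2"
    using P' Q' unfolding a_def s_def l n v by algebra
  hence x0: "x0 = x2 + d * a" by simp
  \<comment> \<open>The difference of the two second Vieta equations, after elimination of
    \<open>v\<close> and \<open>x0\<close>, is divisible by \<open>d\<close>.\<close>
  have "d * (2 * k) = d * (b * x2 + d * x1 - a * u)"
    using P' Q' m unfolding l n v x0 by algebra
  hence k: "2 * k = b * x2 + d * x1 - a * u"
    using d by simp
  have "collinear_abscissae u x2 X s r"
    unfolding collinear_abscissae_def
  proof (intro conjI)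
    show "u + x2 + X = s\<^sup>2 - curve_A" 
      using P' m unfolding X_def s_def l x0 by algebra
    show "u * x2 + u * X + x2 * X = 1 - 2 * s * r"
      using P' m k unfolding X_def s_def l x0 r_def n by algebra
    show "u * x2 * X = r\<^sup>2"
      using P' m k unfolding X_def s_def l x0 r_def n by algebra
  qed
  moreover have "s * u + r = - (l * u + n)"
    using m k unfolding s_def r_def l n by algebra
  moreover have "s * x2 + r = m * x2 + k"
    unfolding s_def r_def by algebra
  ultimately show ?thesis
    using da by (intro that) (simp_all add: X_def a_def s_def b_def d_def)
qed


section \<open>Negation and membership in the curve\<close>

fun neg_pt :: "'a::field point \<Rightarrow> 'a point" where
  "neg_pt Infinity = Infinity"
| "neg_pt (Affine x y) = Affine x (- y)"

lemma neg_pt_neg_pt [simp]: "neg_pt (neg_pt P) = P"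
  by (cases P) auto

lemma neg_pt_eq_iff: "neg_pt P = neg_pt Q \<longleftrightarrow> P = Q"
  by (metis neg_pt_neg_pt)

lemma neg_pt_in_EC_iff [simp]: "neg_pt P \<in> EC \<longleftrightarrow> P \<in> EC"
  by (cases P) (auto simp: EC_def)

lemma Infinity_in_EC [simp]: "Infinity \<in> EC"
  by (simp add: EC_def)

lemma Affine_in_EC_iff: "Affine x y \<in> EC \<longleftrightarrow> y\<^sup>2 = x ^ 3 + curve_A * x\<^sup>2 + x"
  by (auto simp: EC_def)

lemma Infinity_ec_add [simp]: "Infinity \<oplus> P = P"
  by (cases P) auto

lemma ec_add_neg_pt [simp]: "P \<oplus> neg_pt P = Infinity" "neg_pt P \<oplus> P = Infinity"
  by (cases P; simp)+

section \<open>Collinear triples and the addition law\<close>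

text \<open>Points may coincide, with multiplicity recorded by the root triple. Vertical lines have
  no slope \<open>l\<close>, so sums equal to \<open>Infinity\<close> are treated
  separately.\<close>

definition collinear :: "'a::field point \<Rightarrow> 'a point \<Rightarrow> 'a point \<Rightarrow> 'a \<Rightarrow> 'a \<Rightarrow> bool" where
  "collinear P Q R l n \<longleftrightarrow> (\<exists>x1 x2 x3.
     P = Affine x1 (l * x1 + n) \<and> Q = Affine x2 (l * x2 + n) \<and> R = Affine x3 (l * x3 + n) \<and>
     collinear_abscissae x1 x2 x3 l n)"

lemma collinear_swap: "collinear P Q R l n \<Longrightarrow> collinear Q P R l n"
  unfolding collinear_def collinear_abscissae_def by (force simp: algebra_simps)

lemma collinear_rotate: "collinear P Q R l n \<Longrightarrow> collinear Q R P l n"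
  unfolding collinear_def collinear_abscissae_def by (force simp: algebra_simps)

lemma collinear_neg_pt:
  "collinear P Q R l n \<Longrightarrow> collinear (neg_pt P) (neg_pt Q) (neg_pt R) (- l) (- n)"
  unfolding collinear_def collinear_abscissae_def by (force simp: algebra_simps)

lemma collinear_in_EC:
  assumes "collinear P Q R l n"
  shows "R \<in> EC"
proof -
  from assms obtain x1 x2 x3 where R: "R = Affine x3 (l * x3 + n)"
      and c: "collinear_abscissae x1 x2 x3 l n"
    unfolding collinear_def by blast
  show ?thesis
    unfolding R Affine_in_EC_iff using c[unfolded collinear_abscissae_def] by algebra
qed

lemma ex_collinear:
  fixes P Q :: "'a::field point"
  assumes two: "(2::'a) \<noteq> 0"
    and P: "P \<in> EC - {Infinity}" and Q: "Q \<in> EC - {Infinity}" and ne: "Q \<noteq> neg_pt P"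
  obtains R l n where "collinear P Q R l n"
proof -
  obtain x1 y1 where P1: "P = Affine x1 y1" using P by (cases P) auto
  obtain x2 y2 where Q1: "Q = Affine x2 y2" using Q by (cases Q) auto
  have c1: "y1\<^sup>2 = x1 ^ 3 + curve_A * x1\<^sup>2 + x1" and c2: "y2\<^sup>2 = x2 ^ 3 + curve_A * x2\<^sup>2 + x2"
    using P Q by (auto simp: P1 Q1 Affine_in_EC_iff)
  define l where "l = (if x1 \<noteq> x2 then (y2 - y1) / (x2 - x1)
                else (3 * x1\<^sup>2 + 2 * curve_A * x1 + 1) / (2 * y1))"
  define n where "n = y1 - l * x1"
  define x3 where "x3 = l\<^sup>2 - curve_A - x1 - x2"
  have y1: "y1 = l * x1 + n" by (simp add: n_def)
  have "y2 = l * x2 + n \<and> collinear_abscissae x1 x2 x3 l n"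
  proof (cases "x1 = x2")
    case True
    have "(y2 - y1) * (y2 + y1) = 0" using c1 c2 True by algebra
    moreover have "y2 + y1 \<noteq> 0" using ne True by (auto simp: P1 Q1 eq_neg_iff_add_eq_0)
    ultimately have y: "y2 = y1" by simp
    with two \<open>y2 + y1 \<noteq> 0\<close> have "y1 \<noteq> 0" by auto
    with True two have "l * (2 * y1) = 3 * x1\<^sup>2 + 2 * curve_A * x1 + 1"
      by (simp add: l_def)
    then have "collinear_abscissae x1 x1 x3 l n"
      unfolding collinear_abscissae_def using c1 True by (simp add: x3_def n_def) algebra
    with True y y1 show ?thesis by simp
  next
    case False
    then have "l * (x2 - x1) = y2 - y1" by (simp add: l_def)
    then have y2: "y2 = l * x2 + n" by (simp add: n_def algebra_simps)
    \<comment> \<open>The difference of the two curve equations yields this relation only up to the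
      factor \<open>x2 - x1\<close>, which is nonzero for a chord.\<close>
    have "(x2 - x1) * (x1 * x2 + x1 * x3 + x2 * x3) = (x2 - x1) * (1 - 2 * l * n)"
      using c1 c2 unfolding y1 y2 x3_def by algebra
    then have e2: "x1 * x2 + x1 * x3 + x2 * x3 = 1 - 2 * l * n"
      using False by simp
    moreover have "x1 * x2 * x3 = n\<^sup>2"
      using c1 e2 unfolding y1 x3_def by algebra
    ultimately show ?thesis
      using y2 by (simp add: collinear_abscissae_def x3_def)
  qed
  with y1 show ?thesis
    by (intro that[of "Affine x3 (l * x3 + n)" l n]) (simp add: P1 Q1 collinear_def)
qed

text \<open>The slope of the line is recovered from the triple, so it agrees with the slope that
  \<open>ec_add\<close> computes.\<close>

lemma ec_add_collinear:
  fixes P Q :: "'a::field point"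
  assumes two: "(2::'a) \<noteq> 0" and col: "collinear P Q R l n" and ne: "Q \<noteq> neg_pt P"
  shows "P \<oplus> Q = neg_pt R"
proof -
  obtain x1 x2 x3 where P: "P = Affine x1 (l * x1 + n)" and Q: "Q = Affine x2 (l * x2 + n)"
      and R: "R = Affine x3 (l * x3 + n)" and c: "collinear_abscissae x1 x2 x3 l n"
    using col unfolding collinear_def by blast
  note c = c[unfolded collinear_abscissae_def]
  have slope: "(if x1 \<noteq> x2 then (l * x2 + n - (l * x1 + n)) / (x2 - x1)
      else (3 * x1\<^sup>2 + 2 * curve_A * x1 + 1) / (2 * (l * x1 + n))) = l"
  proof (cases "x1 = x2")
    case True
    have "l * x1 + n \<noteq> - (l * x1 + n)"
      using ne True unfolding P Q neg_pt.simps by metis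
    then have "l * x1 + n \<noteq> 0"
      by (metis add.inverse_neutral)
    then have "2 * (l * x1 + n) \<noteq> 0"
      using two by (simp only: mult_eq_0_iff simp_thms)
    \<comment> \<open>The derivative of the cubic vanishes at the double root
      \<open>x1\<close>.\<close>
    moreover have "3 * x1\<^sup>2 + 2 * curve_A * x1 + 1 = l * (2 * (l * x1 + n))"
      using c unfolding True by algebra
    ultimately show ?thesis
      using True by (simp only: nonzero_mult_div_cancel_right simp_thms if_False)
  next
    case False
    then have "x2 - x1 \<noteq> 0" by simp
    moreover have "l * x2 + n - (l * x1 + n) = l * (x2 - x1)" by algebra
    ultimately show ?thesis using False by simp
  qed
  have x3: "l\<^sup>2 - curve_A - x1 - x2 = x3" using c by algebra
  have y3: "l * (x1 - x3) - (l * x1 + n) = - (l * x3 + n)" by algebra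
  have "\<not> (x2 = x1 \<and> l * x2 + n = - (l * x1 + n))"
    using ne unfolding P Q neg_pt.simps point.inject .
  then show ?thesis
    unfolding P Q R neg_pt.simps ec_add.simps Let_def slope x3 y3 by (rule if_not_P)
qed

lemma ec_add_cases:
  fixes P Q :: "'a::field point"
  assumes "(2::'a) \<noteq> 0" "P \<in> EC" "Q \<in> EC"
  obtains "P = Infinity" | "Q = Infinity" | "Q = neg_pt P"
    | R l n where "collinear P Q R l n" "Q \<noteq> neg_pt P" "P \<oplus> Q = neg_pt R"
proof (cases "P = Infinity \<or> Q = Infinity \<or> Q = neg_pt P")
  case True
  then show ?thesis using that(1-3) by blast
next
  case False
  with assms obtain R l n where col: "collinear P Q R l n"
    using ex_collinear[of P Q] by (metis DiffI singletonD)
  moreover from False have "Q \<noteq> neg_pt P" by simp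
  ultimately show ?thesis
    using ec_add_collinear[OF assms(1) col] by (intro that(4))
qed

lemma ec_add_commute:
  fixes P Q :: "'a::field point"
  assumes two: "(2::'a) \<noteq> 0" and "P \<in> EC" "Q \<in> EC"
  shows "P \<oplus> Q = Q \<oplus> P"
  using assms
proof (cases rule: ec_add_cases)
  case (4 R l n)
  then have "P \<noteq> neg_pt Q" by auto
  from ec_add_collinear[OF two collinear_swap[OF 4(1)] this] 4(3) show ?thesis by simp
qed auto

lemma neg_pt_ec_add:
  fixes P Q :: "'a::field point"
  assumes two: "(2::'a) \<noteq> 0" and "P \<in> EC" "Q \<in> EC"
  shows "neg_pt (P \<oplus> Q) = neg_pt P \<oplus> neg_pt Q"
  using assms
proof (cases rule: ec_add_cases)
  case (4 R l n)
  then have "neg_pt Q \<noteq> neg_pt (neg_pt P)" by (auto simp: neg_pt_eq_iff)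
  from ec_add_collinear[OF two collinear_neg_pt[OF 4(1)] this] 4(3) show ?thesis by simp
qed auto

text \<open>
  This is the only place where the curve has to be nonsingular, i.e. \<open>A\<^sup>2 \<noteq> 4\<close>: a line through
  \<open>P\<close>, \<open>- P\<close> and a third affine point would make \<open>P\<close> a singular point.
\<close>

lemma not_collinear_neg_pt:
  fixes P Q :: "'a::field point"
  assumes ns: "(curve_A::'a)\<^sup>2 \<noteq> 4" and two: "(2::'a) \<noteq> 0"
  shows "\<not> collinear P Q (neg_pt P) l n"
proof
  assume "collinear P Q (neg_pt P) l n"
  then obtain x x2 where y: "l * x + n = - (l * x + n)" and c: "collinear_abscissae x x2 x l n"
    unfolding collinear_def by (elim exE conjE) (simp only: neg_pt.simps point.inject, metis)
  have "2 * (l * x + n) = 0" using y by algebra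
  with two have "l * x + n = 0" by (simp only: mult_eq_0_iff simp_thms)
  then have n: "n = - (l * x)" by algebra
  \<comment> \<open>The double root \<open>x\<close> belongs to a point with ordinate 0, so the
    right-hand side of the curve equation vanishes there together with its derivative.\<close>
  have d: "3 * x\<^sup>2 + 2 * curve_A * x + 1 = 0" and "x * (x\<^sup>2 + curve_A * x + 1) = 0"
    using c unfolding collinear_abscissae_def n by algebra+
  moreover from d have "x \<noteq> 0" by auto
  ultimately have q: "x\<^sup>2 + curve_A * x + 1 = 0" by simp
  with d have "x * (2 * x + curve_A) = 0" by algebra
  with \<open>x \<noteq> 0\<close> have "2 * x + curve_A = 0" by simp
  with q have "(curve_A::'a)\<^sup>2 = 4" by algebra
  with ns show False by simp
qed

section \<open>Cancellation and associativity\<close>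

text \<open>Reflecting the line through \<open>P\<close>, \<open>Q\<close>, \<open>R\<close> gives a
  line through their negatives, on which \<open>neg_pt P\<close> and \<open>neg_pt R\<close> add up
  to \<open>Q\<close>. Nonsingularity keeps these two from being opposite.\<close>

lemma ec_add_cancel_left:
  fixes P Q :: "'a::field point"
  assumes ns: "(curve_A::'a)\<^sup>2 \<noteq> 4" and two: "(2::'a) \<noteq> 0" and "P \<in> EC" "Q \<in> EC"
  shows "neg_pt P \<oplus> (P \<oplus> Q) = Q"
  using two assms(3,4)
proof (cases rule: ec_add_cases)
  case (4 R l n)
  have "R \<noteq> neg_pt P" using not_collinear_neg_pt[OF ns two] 4(1) by blast
  then have "neg_pt R \<noteq> neg_pt (neg_pt P)" unfolding neg_pt_eq_iff .
  moreover have "collinear (neg_pt P) (neg_pt R) (neg_pt Q) (- l) (- n)"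
    using 4(1) by (intro collinear_neg_pt) (blast intro: collinear_swap collinear_rotate)
  ultimately show ?thesis
    using ec_add_collinear[OF two] 4(3) by force
qed auto

lemma ec_add_assoc:
  fixes P0 P1 P2 :: "'a::field point"
  assumes ns: "(curve_A::'a)\<^sup>2 \<noteq> 4" and two: "(2::'a) \<noteq> 0"
    and P0: "P0 \<in> EC - {Infinity}" and P1: "P1 \<in> EC - {Infinity}" and P2: "P2 \<in> EC - {Infinity}"
  shows "(P0 \<oplus> P1) \<oplus> P2 = P0 \<oplus> (P1 \<oplus> P2)"
proof -
  have EC: "P0 \<in> EC" "P1 \<in> EC" "P2 \<in> EC" using P0 P1 P2 by auto
  note comm = ec_add_commute[OF two] and sum = ec_add_collinear[OF two]
    and cancel = ec_add_cancel_left[OF ns two]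
  consider "P1 = neg_pt P0" | "P2 = neg_pt P1" | "P1 \<noteq> neg_pt P0" "P2 \<noteq> neg_pt P1"
    by blast
  then show ?thesis
  proof cases
    case 1
    then show ?thesis using cancel[of "neg_pt P0" P2] EC by simp
  next
    case 2
    have "P0 \<oplus> P1 \<in> EC"
      using two EC(1,2)
      by (cases rule: ec_add_cases) (use EC in \<open>auto dest: collinear_in_EC\<close>)
    then show ?thesis
      using 2 cancel[of P1 P0] EC comm[of "P0 \<oplus> P1" "neg_pt P1"] comm[of P0 P1] by simp
  next
    case 3
    then have ne: "P1 \<noteq> neg_pt P2" by auto
    obtain U l n where U: "collinear P0 P1 U l n"
      using ex_collinear[OF two P0 P1 3(1)] .
    obtain V m k where V: "collinear P2 P1 V m k"
      using ex_collinear[OF two P2 P1 ne] .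
    have 01: "P0 \<oplus> P1 = neg_pt U" using sum[OF U 3(1)] .
    have 12: "P1 \<oplus> P2 = neg_pt V" using sum[OF collinear_swap[OF V] 3(2)] .
    obtain x0 x1 u where x: "P0 = Affine x0 (l * x0 + n)" "P1 = Affine x1 (l * x1 + n)"
      "U = Affine u (l * u + n)" and xc: "collinear_abscissae x0 x1 u l n"
      using U unfolding collinear_def by blast
    obtain x2 x1' v where "P1 = Affine x1' (m * x1' + k)" and x': "P2 = Affine x2 (m * x2 + k)"
      "V = Affine v (m * v + k)" and "collinear_abscissae x2 x1' v m k"
      using V unfolding collinear_def by blast
    with x have yc: "collinear_abscissae x2 x1 v m k" and eq: "l * x1 + n = m * x1 + k" by auto
    consider "P2 = U" | "P0 = V" | "P0 = P2" | "P2 \<noteq> U" "P0 \<noteq> V" "l \<noteq> m"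
    proof -
      have "P0 = P2 \<or> P0 = V" if "l = m"
      proof -
        have "n = k" using eq that by simp
        \<comment> \<open>On a common line, removing the shared root \<open>x1\<close> leaves one
          quadratic with roots \<open>x0\<close>, \<open>u\<close> and also \<open>x2\<close>,
          \<open>v\<close>.\<close>
        moreover have "(x0 - x2) * (x0 - v) = 0"
          using xc yc that \<open>n = k\<close> unfolding collinear_abscissae_def by algebra
        ultimately show ?thesis using that x x' by auto
      qed
      with that show thesis by blast
    qed
    then show ?thesis
    proof cases
      case 1
      \<comment> \<open>All three points lie on one line, so both sides of the claim are
        \<open>Infinity\<close>.\<close>
      have "P1 \<oplus> P2 = neg_pt P0"
        using sum[OF collinear_rotate[OF U]] 1 3 by simp
      then show ?thesis using 01 1 by simp
    next
      case 2
      have "P0 \<oplus> P1 = neg_pt P2"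
        using sum[OF collinear_swap[OF collinear_rotate[OF V]]] 2 3 by simp
      then show ?thesis using 12 2 by simp
    next
      case 3
      have "P0 \<oplus> P1 \<in> EC"
        using collinear_in_EC[OF U] 01 by simp
      then show ?thesis using comm[of P0 "P0 \<oplus> P1"] comm[of P0 P1] EC 3 by simp
    next
      case 4
      obtain X s r where s: "collinear_abscissae u x2 X s r" "s * u + r = - (l * u + n)"
        "s * x2 + r = m * x2 + k" "s = m + (v - u) / (l - m)" "X = x1 + (s + l) * (s - m)"
        "(l - m) * (s + l) = x0 - x2"
        using collinear_abscissae_exchange[OF xc yc eq 4(3)] .
      obtain X' t w where t: "collinear_abscissae v x0 X' t w" "t * v + w = - (m * v + k)"
        "t * x0 + w = l * x0 + n" "t = l + (u - v) / (m - l)" "X' = x1 + (t + m) * (t - l)"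
        "(m - l) * (t + m) = x2 - x0"
        using collinear_abscissae_exchange[OF yc xc eq[symmetric] 4(3)[symmetric]] .
      \<comment> \<open>The increment of the slope is symmetric in the two lines, so
        \<open>t - l\<close> equals \<open>s - m\<close> and both applications give the same
        abscissa.\<close>
      have "(u - v) / (m - l) = (v - u) / (l - m)"
        by (metis minus_diff_eq minus_divide_divide)
      then have ts: "t = s + (l - m)" using s(4) t(4) by simp
      then have X: "X' = X" using s(5) t(5) by simp
      \<comment> \<open>The ordinates agree too, so both sums are the negative of one point.\<close>
      have "t * X + w = s * X + r"
        using s(3,5,6) t(3) eq unfolding ts by algebra
      then have "collinear (neg_pt V) P0 (Affine X (s * X + r)) t w"
        using t X unfolding collinear_def by (auto simp: x x')
      moreover have "collinear (neg_pt U) P2 (Affine X (s * X + r)) s r"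
        using s unfolding collinear_def by (auto simp: x x')
      ultimately have "neg_pt U \<oplus> P2 = neg_pt V \<oplus> P0"
        using sum 4 by simp
      moreover have "neg_pt V \<in> EC" using collinear_in_EC[OF V] by simp
      ultimately show ?thesis
        using comm[of P0 "neg_pt V"] EC 01 12 by simp
    qed
  qed
qed

theorem lemma7p11:
  fixes P0 P1 P2 :: "'a :: field point"
  assumes "CARD('a) = p25519"
    and "P0 \<in> EC - {Infinity}" and "P1 \<in> EC - {Infinity}" and "P2 \<in> EC - {Infinity}"
  shows "(P0 \<oplus> P1) \<oplus> P2 = P0 \<oplus> (P1 \<oplus> P2)"
proof -
  have ns: "(curve_A::'a)\<^sup>2 \<noteq> 4"
    using assms(1) by (rule curve_A_square_ne_4)
  moreover have "(2::'a) \<noteq> 0"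
  proof
    assume two: "(2::'a) = 0"
    \<comment> \<open>In characteristic 2 both the even number \<open>curve_A\<close> and 4 would
      vanish, contradicting \<open>ns\<close>.\<close>
    have "curve_A = 2 * (243331::'a)" "4 = 2 * (2::'a)" by (simp_all add: curve_A_def)
    then have "(curve_A::'a) = 0" "4 = (0::'a)" by (simp_all only: two mult_zero_left)
    with ns show False by simp
  qed
  ultimately show ?thesis
    using assms(2-4) by (rule ec_add_assoc)
qed

end
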